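(* For $m,n\in\mathbb{N}=\{1,2,3,\dots\}$ define $f_{m,n}(x)=\psi^{(n)}(x)+\bigl[\psi^{(m)}(x)\bigr]^2$ for $x\in(0,\infty)$. Then: (i) the function $f_{1,2}$ is completely monotonic on $(0,\infty)$; (ii) for all $m,n\in\mathbb{N}$, the function $f_{m,2n-1}$ is completely monotonic on $(0,\infty)$; (iii) for all $m,n\in\mathbb{N}$ with $(m,n)\neq(1,1)$, the function $f_{m,2n}$ is not monotonic on $(0,\infty)$ (it is neither increasing nor decreasing on $(0,\infty)$) and does not keep the same sign on $(0,\infty)$ (it takes both positive and negative values there).
   Context: Here $\Gamma(x)=\int_0^\infty t^{x-1}e^{-t}\,dt$ for $x>0$ is the Euler gamma function, $\psi(x)=\Gamma'(x)/\Gamma(x)$ is the psi (digamma) function on $(0,\infty)$, and for $i\in\mathbb{N}$, $\psi^{(i)}$ denotes the $i$-th derivative of $\psi$ (a polygamma function). A function $f$ is completely monotonic on an interval $I$ if $f$ has derivatives of all orders on $I$ and $(-1)^{k}f^{(k)}(x)\ge 0$ for all $x\in I$ and all integers $k\ge 0$. *)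

theory Defs
  imports "HOL-Analysis.Analysis"
begin

text \<open>
  \<^const>\<open>Digamma\<close> and \<^const>\<open>Polygamma\<close> are defined by series in the library. On the positive
  reals they are the logarithmic derivative of \<^const>\<open>Gamma\<close> and its iterated derivatives;
  the integral formula for \<^const>\<open>Gamma\<close> is \<open>Gamma_integral_real\<close>.
\<close>

lemma Digamma_eq_log_deriv_Gamma:
  fixes x :: real
  assumes "x > 0"
  shows "Digamma x = deriv Gamma x / Gamma x"
proof -
  from assms have "x \<notin> \<int>\<^sub>\<le>\<^sub>0"
    by auto
  then have "(Gamma has_field_derivative Gamma x * Digamma x) (at x)"
    by (rule has_field_derivative_Gamma)
  then have "deriv Gamma x = Gamma x * Digamma x"
    by (rule DERIV_imp_deriv)
  moreover have "Gamma x > 0"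
    using assms by (rule Gamma_real_pos)
  ultimately show ?thesis
    by simp
qed

lemma higher_deriv_Digamma:
  fixes x :: real
  assumes "x > 0"
  shows "(deriv ^^ i) Digamma x = Polygamma i x"
  using assms
proof (induction i arbitrary: x)
  case (Suc i)
  have "eventually (\<lambda>y. y \<in> {0<..}) (nhds x)"
    using Suc.prems by (intro eventually_nhds_in_open) auto
  then have "eventually (\<lambda>y. (deriv ^^ i) Digamma y = Polygamma i y) (nhds x)"
    by eventually_elim (simp add: Suc.IH)
  then have "deriv ((deriv ^^ i) Digamma) x = deriv (Polygamma i) x"
    by (intro deriv_cong_ev) auto
  also from Suc.prems have "x \<notin> \<int>\<^sub>\<le>\<^sub>0"
    by auto
  then have "deriv (Polygamma i) x = Polygamma (Suc i) x"
    by (rule deriv_Polygamma)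
  finally show ?case
    by simp
qed simp

text \<open>
  Derivatives are two-sided, so this is the usual notion for open intervals \<open>I\<close>; for
  other intervals it is stronger at the endpoints and depends on \<open>f\<close> outside \<open>I\<close>.
\<close>

definition completely_monotonic_on :: "real set \<Rightarrow> (real \<Rightarrow> real) \<Rightarrow> bool" where
  "completely_monotonic_on I f \<longleftrightarrow>
     (\<forall>k. \<forall>x\<in>I. (deriv ^^ k) f differentiable (at x)) \<and>
     (\<forall>k. \<forall>x\<in>I. (-1) ^ k * (deriv ^^ k) f x \<ge> 0)"

definition polygamma_fun :: "nat \<Rightarrow> nat \<Rightarrow> real \<Rightarrow> real" where
  "polygamma_fun m n x = Polygamma n x + (Polygamma m x)\<^sup>2"

end

theory Submission
  imports Defs "HOL-Real_Asymp.Real_Asymp"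
begin

text \<open>
  Write \<open>P\<^sub>n\<close> for \<open>(-1)\<^sup>n\<^sup>+\<^sup>1 \<psi>\<^sup>(\<^sup>n\<^sup>)\<close>. For \<open>n \<ge> 1\<close> this is a positive function with derivative
  \<open>- P\<^bsub>n+1\<^esub>\<close>, hence completely monotonic, and \<open>P\<^sub>n(x) - P\<^sub>n(x + 1) = n! / x\<^sup>n\<^sup>+\<^sup>1\<close>. Everything follows from
  this recurrence and from the mean value theorem; no integral representation enters.

  Completely monotonic functions are closed under sums and products, and
  \<open>f\<^bsub>m,2n-1\<^esub> = P\<^sub>m\<^sup>2 + P\<^bsub>2n-1\<^esub>\<close>, which settles the odd case.

  The function \<open>f\<^bsub>1,2\<^esub> = P\<^sub>1\<^sup>2 - P\<^sub>2\<close> is a difference. If \<open>h\<close> and all its derivatives vanish at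
  infinity, then \<open>h\<close> is the telescoping sum of \<open>h(x + k) - h(x + k + 1)\<close>, so \<open>h\<close> is completely
  monotonic as soon as \<open>h(x) - h(x + 1)\<close> is (\<open>completely_monotonic_on_diffI\<close>). This is used twice.
  The recurrence gives
  \<open>f\<^bsub>1,2\<^esub>(x) - f\<^bsub>1,2\<^esub>(x + 1) = (2 / x\<^sup>2) g(x)\<close> with \<open>g(x) = P\<^sub>1(x) - 1/x - 1/(2 x\<^sup>2)\<close>, and for \<open>g\<close> in turn
  \<open>g(x) - g(x + 1) = (1/x - 1/(x + 1))\<^sup>2 / 2 = (1 / (x (x + 1)))\<^sup>2 / 2\<close>, which is visibly
  completely monotonic.

  For \<open>f\<^bsub>m,2n\<^esub> = P\<^sub>m\<^sup>2 - P\<^bsub>2n\<^esub>\<close> the signs can be read off from \<open>P\<^sub>k(x) \<sim> (k-1)! / x\<^sup>k\<close> at infinity and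
  \<open>P\<^sub>k(x) \<sim> k! / x\<^sup>k\<^sup>+\<^sup>1\<close> at 0. For \<open>m < n\<close> the square dominates at infinity and \<open>P\<^bsub>2n\<^esub>\<close> at 0. For
  \<open>m \<ge> n\<close> the square dominates at 0; at infinity \<open>P\<^bsub>2n\<^esub>\<close> dominates, for \<open>m = n \<ge> 2\<close> through the
  constants \<open>((n-1)!)\<^sup>2 < (2n-1)!\<close>. These constants agree for \<open>m = n = 1\<close>, the excluded case.
  Finally, a function that tends to 0 at infinity and takes both signs is not monotone.
\<close>

section \<open>Calculus of completely monotonic functions\<close>

text \<open>
  Complete monotonicity up to the order \<open>n\<close>, in a form without iterated derivatives: \<open>f\<close> is
  nonnegative and \<open>- f'\<close> has the property of order \<open>n - 1\<close>. This recursion makes closure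
  properties provable by induction on the order.
\<close>

primrec cm_upto :: "nat \<Rightarrow> real set \<Rightarrow> (real \<Rightarrow> real) \<Rightarrow> bool" where
  "cm_upto 0 I f \<longleftrightarrow> (\<forall>x\<in>I. f x \<ge> 0)"
| "cm_upto (Suc n) I f \<longleftrightarrow> (\<forall>x\<in>I. f x \<ge> 0) \<and>
     (\<exists>g. (\<forall>x\<in>I. (f has_real_derivative - g x) (at x)) \<and> cm_upto n I g)"

lemma has_real_derivative_cong_open:
  fixes f g :: "real \<Rightarrow> real"
  assumes "open I" "x \<in> I" "\<And>y. y \<in> I \<Longrightarrow> f y = g y" "(f has_real_derivative D) (at x)"
  shows "(g has_real_derivative D) (at x)"
  using has_field_derivative_transform_within_open[OF assms(4,1,2)] assms(3) by auto

lemma cm_upto_SucI: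
  assumes "\<And>x. x \<in> I \<Longrightarrow> f x \<ge> 0"
    and "\<And>x. x \<in> I \<Longrightarrow> (f has_real_derivative - g x) (at x)" "cm_upto n I g"
  shows "cm_upto (Suc n) I f"
  using assms by auto

lemma cm_upto_nonneg: "cm_upto n I f \<Longrightarrow> x \<in> I \<Longrightarrow> f x \<ge> 0"
  by (cases n) auto

lemma cm_upto_cong:
  assumes "open I" "\<And>x. x \<in> I \<Longrightarrow> f x = g x" "cm_upto n I f"
  shows "cm_upto n I g"
proof (cases n)
  case 0
  then show ?thesis using assms by auto
next
  case (Suc k)
  then obtain h where h: "\<forall>x\<in>I. (f has_real_derivative - h x) (at x)" "cm_upto k I h"
    using assms(3) by auto
  then have "\<forall>x\<in>I. (g has_real_derivative - h x) (at x)"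
    by (intro ballI has_real_derivative_cong_open[of I _ f g]) (use assms in auto)
  then show ?thesis
    using Suc h assms by auto
qed

lemma cm_upto_SucD: "cm_upto (Suc n) I f \<Longrightarrow> cm_upto n I f"
  by (induction n arbitrary: f) auto

lemma cm_upto_add:
  "cm_upto n I f \<Longrightarrow> cm_upto n I g \<Longrightarrow> cm_upto n I (\<lambda>x. f x + g x)"
proof (induction n arbitrary: f g)
  case (Suc n)
  from Suc.prems obtain f' g' where
    "\<forall>x\<in>I. (f has_real_derivative - f' x) (at x)" "cm_upto n I f'"
    "\<forall>x\<in>I. (g has_real_derivative - g' x) (at x)" "cm_upto n I g'"
    by auto
  moreover have "\<forall>x\<in>I. f x + g x \<ge> 0"
    using Suc.prems by auto
  ultimately show ?case
    by (intro cm_upto_SucI[where g = "\<lambda>x. f' x + g' x"] Suc.IH) (auto intro!: derivative_eq_intros)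
qed auto

text \<open>
  The induction rests on \<open>- (f g)' = (- f') g + f (- g')\<close> and closure under sums. It replaces
  Leibniz' formula for the higher derivatives of a product.
\<close>

lemma cm_upto_mult:
  "cm_upto n I f \<Longrightarrow> cm_upto n I g \<Longrightarrow> cm_upto n I (\<lambda>x. f x * g x)"
proof (induction n arbitrary: f g)
  case (Suc n)
  from Suc.prems obtain f' g' where *:
    "\<forall>x\<in>I. (f has_real_derivative - f' x) (at x)" "cm_upto n I f'"
    "\<forall>x\<in>I. (g has_real_derivative - g' x) (at x)" "cm_upto n I g'"
    by auto
  have "cm_upto n I (\<lambda>x. f' x * g x + f x * g' x)"
    by (intro cm_upto_add Suc.IH * Suc.prems[THEN cm_upto_SucD])
  moreover have "\<forall>x\<in>I. f x * g x \<ge> 0"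
    using Suc.prems by auto
  moreover have "\<forall>x\<in>I. ((\<lambda>x. f x * g x) has_real_derivative - (f' x * g x + f x * g' x)) (at x)"
    using * by (auto intro!: derivative_eq_intros)
  ultimately show ?case
    by (intro cm_upto_SucI[where g = "\<lambda>x. f' x * g x + f x * g' x"]) blast+
qed auto

lemma completely_monotonic_on_iff_cm_upto:
  assumes "open I"
  shows "completely_monotonic_on I f \<longleftrightarrow> (\<forall>n. cm_upto n I f)"
proof
  assume cm: "completely_monotonic_on I f"
  have "cm_upto n I (\<lambda>x. (-1) ^ k * (deriv ^^ k) f x)" for n k
  proof (induction n arbitrary: k)
    case 0
    show ?case using cm by (simp add: completely_monotonic_on_def)
  next
    case (Suc n)
    have "((deriv ^^ k) f has_real_derivative (deriv ^^ Suc k) f x) (at x)" if "x \<in> I" for x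
      using cm that
      by (simp add: completely_monotonic_on_def DERIV_deriv_iff_real_differentiable)
    then have "\<forall>x\<in>I. ((\<lambda>x. (-1) ^ k * (deriv ^^ k) f x) has_real_derivative
        - ((-1) ^ Suc k * (deriv ^^ Suc k) f x)) (at x)"
      by (auto intro!: derivative_eq_intros)
    with Suc[of "Suc k"] cm show ?case
      by (intro cm_upto_SucI[where g = "\<lambda>x. (-1) ^ Suc k * (deriv ^^ Suc k) f x"])
         (simp_all only: completely_monotonic_on_def)
  qed
  from this[of _ 0] show "\<forall>n. cm_upto n I f"
    by simp
next
  assume f: "\<forall>n. cm_upto n I f"
  have deriv: "cm_upto n I (\<lambda>x. (-1) ^ k * (deriv ^^ k) f x)" for n k
  proof (induction k arbitrary: n)
    case 0
    show ?case using f by simp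
  next
    case (Suc k)
    from Suc[of "Suc n"] obtain g where
      g: "\<And>x. x \<in> I \<Longrightarrow> ((\<lambda>x. (-1) ^ k * (deriv ^^ k) f x) has_real_derivative - g x) (at x)"
        "cm_upto n I g"
      by auto
    have "g x = (-1) ^ Suc k * (deriv ^^ Suc k) f x" if "x \<in> I" for x
    proof -
      have "((\<lambda>x. (-1) ^ k * ((-1) ^ k * (deriv ^^ k) f x)) has_real_derivative
          (-1) ^ k * (- g x)) (at x)"
        by (intro DERIV_cmult g that)
      then have "((deriv ^^ k) f has_real_derivative (-1) ^ k * (- g x)) (at x)"
        by (simp add: mult.assoc[symmetric] flip: power_add mult_2)
      then have "(deriv ^^ Suc k) f x = (-1) ^ k * (- g x)"
        by (simp add: DERIV_imp_deriv)
      then show ?thesis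
        by (simp add: mult.assoc[symmetric] flip: power_add mult_2)
    qed
    then show ?case
      by (rule cm_upto_cong[OF assms _ g(2)])
  qed
  show "completely_monotonic_on I f"
    unfolding completely_monotonic_on_def
  proof (intro conjI allI ballI)
    fix k x
    assume x: "x \<in> I"
    show "(-1) ^ k * (deriv ^^ k) f x \<ge> 0"
      using cm_upto_nonneg[OF deriv x] .
    from deriv[of 1 k] x obtain D where
      "((\<lambda>x. (-1) ^ k * (deriv ^^ k) f x) has_real_derivative D) (at x)"
      by auto
    from DERIV_cmult[OF this, of "(-1) ^ k"]
    show "(deriv ^^ k) f differentiable (at x)"
      by (auto simp: mult.assoc[symmetric] real_differentiable_def simp flip: power_add mult_2)
  qed
qed

lemma completely_monotonic_on_cong:
  assumes "open I" "\<And>x. x \<in> I \<Longrightarrow> f x = g x" "completely_monotonic_on I f"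
  shows "completely_monotonic_on I g"
  using assms(3) cm_upto_cong[OF assms(1,2)]
  by (simp add: completely_monotonic_on_iff_cm_upto assms(1))

lemma completely_monotonic_on_add:
  assumes "open I" "completely_monotonic_on I f" "completely_monotonic_on I g"
  shows "completely_monotonic_on I (\<lambda>x. f x + g x)"
  using assms by (simp add: completely_monotonic_on_iff_cm_upto cm_upto_add)

lemma completely_monotonic_on_mult:
  assumes "open I" "completely_monotonic_on I f" "completely_monotonic_on I g"
  shows "completely_monotonic_on I (\<lambda>x. f x * g x)"
  using assms by (simp add: completely_monotonic_on_iff_cm_upto cm_upto_mult)

lemma completely_monotonic_on_power:
  fixes a c :: real
  assumes "a \<ge> 0" "c \<ge> 0"
  shows "completely_monotonic_on {0<..} (\<lambda>x. c / (x + a) ^ p)"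
proof -
  have "cm_upto n {0<..} (\<lambda>x. c / (x + a) ^ p)" for n
    using assms(2)
  proof (induction n arbitrary: c p)
    case 0
    then show ?case using assms(1) by auto
  next
    case (Suc n)
    have "((\<lambda>x. c / (x + a) ^ p) has_real_derivative - ((c * p) / (x + a) ^ Suc p)) (at x)"
      if "x \<in> {0<..}" for x
    proof -
      have "- (c * (p * y ^ (p - 1))) / (y ^ p * y ^ p) = - (c * p / y ^ Suc p)"
        if "y \<noteq> 0" for y :: real
        using that by (cases p) (simp_all add: field_simps)
      moreover have "((\<lambda>x. c / (x + a) ^ p) has_real_derivative
          - (c * (p * (x + a) ^ (p - 1))) / ((x + a) ^ p * (x + a) ^ p)) (at x)"
        using that assms(1) by (auto intro!: derivative_eq_intros)
      ultimately show ?thesis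
        using that assms(1) by (metis add_pos_nonneg greaterThan_iff less_irrefl)
    qed
    moreover have "cm_upto n {0<..} (\<lambda>x. (c * p) / (x + a) ^ Suc p)"
      using Suc.prems by (intro Suc.IH) auto
    ultimately show ?case
      using Suc.prems assms(1)
      by (intro cm_upto_SucI[where g = "\<lambda>x. (c * p) / (x + a) ^ Suc p"]) auto
  qed
  then show ?thesis
    by (simp add: completely_monotonic_on_iff_cm_upto)
qed

lemma completely_monotonic_on_has_derivative:
  assumes "completely_monotonic_on I f" "x \<in> I"
  shows "((deriv ^^ k) f has_real_derivative (deriv ^^ Suc k) f x) (at x)"
  using assms by (simp add: completely_monotonic_on_def DERIV_deriv_iff_real_differentiable)

text \<open>
  With \<open>g\<^sub>j = (-1)\<^sup>j f\<^sup>(\<^sup>j\<^sup>)\<close>, each \<open>g\<^sub>j\<close> is nonnegative and decreasing and \<open>g\<^sub>j' = - g\<^bsub>j+1\<^esub>\<close>. The mean value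
  theorem gives \<open>g\<^bsub>k+1\<^esub>(x + 1) \<le> g\<^sub>k(x) - g\<^sub>k(x + 1) \<le> g\<^sub>k(x)\<close>, so the limit 0 passes from \<open>g\<^sub>k\<close> to \<open>g\<^bsub>k+1\<^esub>\<close>.
\<close>

lemma completely_monotonic_on_tendsto_0_deriv:
  assumes cm: "completely_monotonic_on {0<..} f" and lim: "(f \<longlongrightarrow> 0) at_top"
  shows "((deriv ^^ k) f \<longlongrightarrow> 0) at_top"
proof (induction k)
  case 0
  show ?case using lim by simp
next
  case (Suc k)
  define g where "g j x = (-1) ^ j * (deriv ^^ j) f x" for j x
  have g_deriv: "(g j has_real_derivative - g (Suc j) x) (at x)" if "x > 0" for j x
    unfolding g_def using completely_monotonic_on_has_derivative[OF cm] that
    by (auto intro!: derivative_eq_intros)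
  have g_nonneg: "g j x \<ge> 0" if "x > 0" for j x
    using cm that by (simp add: g_def completely_monotonic_on_def)
  have g_antimono: "g j y \<le> g j x" if "0 < x" "x \<le> y" for j x y
  proof (rule DERIV_nonpos_imp_nonincreasing[OF that(2)])
    fix t assume "x \<le> t" "t \<le> y"
    then show "\<exists>D. (g j has_real_derivative D) (at t) \<and> D \<le> 0"
      using that(1) g_deriv[of t j] g_nonneg[of t "Suc j"] by force
  qed
  have bound: "g (Suc k) (x + 1) \<le> g k x" if "x > 0" for x
  proof -
    have "\<exists>z>x. z < x + 1 \<and> g k (x + 1) - g k x = (x + 1 - x) * (- g (Suc k) z)"
      using that by (intro MVT2 g_deriv) auto
    then obtain z where z: "z > x" "z < x + 1"
      "g k (x + 1) - g k x = (x + 1 - x) * (- g (Suc k) z)"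
      by blast
    have "g (Suc k) (x + 1) \<le> g (Suc k) z"
      using z that by (intro g_antimono) auto
    with z g_nonneg[of "x + 1" k] that show ?thesis
      by simp
  qed
  have shift: "filterlim (\<lambda>x::real. x - 1) at_top at_top"
    by real_asymp
  have "(g k \<longlongrightarrow> (-1) ^ k * 0) at_top"
    unfolding g_def by (intro tendsto_intros Suc.IH)
  then have lim_shift: "((\<lambda>x. g k (x - 1)) \<longlongrightarrow> 0) at_top"
    using filterlim_compose[OF _ shift] by simp
  have upper: "eventually (\<lambda>x. g (Suc k) x \<le> g k (x - 1)) at_top"
    using eventually_gt_at_top[of 1] by eventually_elim (use bound[of "x - 1" for x] in force)
  have lower: "eventually (\<lambda>x. 0 \<le> g (Suc k) x) at_top"
    using eventually_gt_at_top[of 0] by eventually_elim (rule g_nonneg)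
  have "(g (Suc k) \<longlongrightarrow> 0) at_top"
    by (rule tendsto_sandwich[OF lower upper tendsto_const lim_shift])
  then have "((\<lambda>x. (-1) ^ Suc k * g (Suc k) x) \<longlongrightarrow> (-1) ^ Suc k * 0) at_top"
    by (intro tendsto_intros)
  then show ?case
    unfolding g_def by (simp add: mult.assoc[symmetric] flip: power_add mult_2)
qed

text \<open>
  Telescoping: by the last hypothesis, \<open>(-1)\<^sup>k (u - v)\<^sup>(\<^sup>k\<^sup>)\<close> does not increase along \<open>x, x + 1, x + 2, \<dots>\<close>,
  and its limit along this sequence is 0, hence it is nonnegative. The hypotheses on \<open>u\<close> and \<open>v\<close>
  are there to ensure that all derivatives of \<open>u - v\<close> exist and vanish at infinity.
\<close>

lemma completely_monotonic_on_diffI: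
  fixes u v :: "real \<Rightarrow> real"
  assumes u: "completely_monotonic_on {0<..} u" "(u \<longlongrightarrow> 0) at_top"
  assumes v: "completely_monotonic_on {0<..} v" "(v \<longlongrightarrow> 0) at_top"
  assumes d: "completely_monotonic_on {0<..} (\<lambda>x. (u x - v x) - (u (x + 1) - v (x + 1)))"
  shows "completely_monotonic_on {0<..} (\<lambda>x. u x - v x)"
proof -
  define D where "D k x = (deriv ^^ k) u x - (deriv ^^ k) v x" for k x
  have D: "(D k has_real_derivative D (Suc k) x) (at x)" if "x > 0" for k x
    unfolding D_def using that
    by (intro DERIV_diff u(1)[THEN completely_monotonic_on_has_derivative]
        v(1)[THEN completely_monotonic_on_has_derivative]) auto
  \<comment> \<open>A chain of pointwise derivatives on the half-line determines the iterated derivatives.\<close>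
  have deriv_eq: "(deriv ^^ k) f x = F k x"
    if "x > 0" "\<And>x. f x = F 0 x"
       "\<And>k x. x > 0 \<Longrightarrow> (F k has_real_derivative F (Suc k) x) (at x)"
    for f :: "real \<Rightarrow> real" and F k x
    using that(1)
  proof (induction k arbitrary: x)
    case 0
    then show ?case using that(2) by simp
  next
    case (Suc k)
    have "((deriv ^^ k) f has_real_derivative F (Suc k) x) (at x)"
      using has_real_derivative_cong_open[of "{0<..}" x "F k"] Suc that(3) by simp
    then show ?case by (simp add: DERIV_imp_deriv)
  qed
  have D_eq: "(deriv ^^ k) (\<lambda>x. u x - v x) x = D k x" if "x > 0" for k x
    using that by (intro deriv_eq D) (auto simp: D_def)
  have shift: "(deriv ^^ k) (\<lambda>x. (u x - v x) - (u (x + 1) - v (x + 1))) x = D k x - D k (x + 1)"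
    if "x > 0" for k x
    using that
  proof (rule deriv_eq[where F = "\<lambda>k x. D k x - D k (x + 1)"])
    fix k and x :: real
    assume "x > 0"
    then have "((\<lambda>x. D k (x + 1)) has_real_derivative D (Suc k) (x + 1)) (at x)"
      using D[of "x + 1" k] DERIV_shift[of "D k" _ x 1] by simp
    with \<open>x > 0\<close> show "((\<lambda>x. D k x - D k (x + 1)) has_real_derivative
        D (Suc k) x - D (Suc k) (x + 1)) (at x)"
      by (intro DERIV_diff D)
  qed (auto simp: D_def)
  have nonneg: "(-1) ^ k * D k x \<ge> 0" if "x > 0" for k x
  proof -
    have step: "(-1) ^ k * D k (x + 1) \<le> (-1) ^ k * D k x" if "x > 0" for x
    proof -
      have "0 \<le> (-1) ^ k * (D k x - D k (x + 1))"
        using d that unfolding shift[OF that, symmetric] completely_monotonic_on_def by blast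
      then show ?thesis
        by (simp only: right_diff_distrib diff_ge_0_iff_ge)
    qed
    have le: "(-1) ^ k * D k (x + real N) \<le> (-1) ^ k * D k x" for N
    proof (induction N)
      case (Suc N)
      with step[of "x + real N"] \<open>x > 0\<close> show ?case
        by (simp add: add_ac)
    qed simp
    have "filterlim (\<lambda>N. x + real N) at_top sequentially"
      by real_asymp
    moreover have "((\<lambda>x. (-1) ^ k * D k x) \<longlongrightarrow> (-1) ^ k * (0 - 0)) at_top"
      unfolding D_def by (intro tendsto_intros completely_monotonic_on_tendsto_0_deriv u v)
    ultimately have "(\<lambda>N. (-1) ^ k * D k (x + real N)) \<longlonglongrightarrow> (-1) ^ k * (0 - 0)"
      by (rule filterlim_compose[rotated])
    from LIMSEQ_le_const2[OF this] le show ?thesis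
      by (simp only: diff_zero mult_zero_right) blast
  qed
  show ?thesis
    unfolding completely_monotonic_on_def
  proof (intro conjI allI ballI)
    fix k and x :: real
    assume "x \<in> {0<..}"
    then have x: "x > 0" by simp
    show "(-1) ^ k * (deriv ^^ k) (\<lambda>x. u x - v x) x \<ge> 0"
      using nonneg x by (simp add: D_eq)
    have "((deriv ^^ k) (\<lambda>x. u x - v x) has_real_derivative D (Suc k) x) (at x)"
      using has_real_derivative_cong_open[of "{0<..}" x "D k"] x D D_eq by simp
    then show "(deriv ^^ k) (\<lambda>x. u x - v x) differentiable (at x)"
      by (auto simp: real_differentiable_def)
  qed
qed

section \<open>Polygamma functions with positive sign\<close>

definition polygamma_pos :: "nat \<Rightarrow> real \<Rightarrow> real" where
  "polygamma_pos n x = (-1) ^ Suc n * Polygamma n x"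

lemma polygamma_pos_nonneg:
  assumes "n > 0" "x > 0"
  shows "polygamma_pos n x \<ge> 0"
proof -
  have "x \<notin> \<int>\<^sub>\<le>\<^sub>0"
    using assms(2) by auto
  then show ?thesis
    using Polygamma_real_odd_pos[of x n] Polygamma_real_even_neg[of x n] assms
    by (cases "even n") (auto simp: polygamma_pos_def intro: less_imp_le)
qed

lemma polygamma_pos_has_derivative:
  assumes "x > 0"
  shows "(polygamma_pos n has_real_derivative - polygamma_pos (Suc n) x) (at x)"
  unfolding polygamma_pos_def [abs_def] using assms
  by (auto intro!: derivative_eq_intros)

lemma polygamma_pos_plus1:
  assumes "x > 0"
  shows "polygamma_pos n (x + 1) = polygamma_pos n x - fact n / x ^ Suc n"
proof -
  have "Polygamma n (x + 1) = Polygamma n x + (-1) ^ n * fact n / x ^ Suc n"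
    using assms by (intro Polygamma_plus1) simp
  then show ?thesis
    unfolding polygamma_pos_def by (cases "even n") auto
qed

lemma completely_monotonic_on_polygamma_pos:
  assumes "n > 0"
  shows "completely_monotonic_on {0<..} (polygamma_pos n)"
proof -
  have "cm_upto k {0<..} (polygamma_pos n)" for k
    using assms
  proof (induction k arbitrary: n)
    case (Suc k)
    then show ?case
      using polygamma_pos_nonneg polygamma_pos_has_derivative
      by (auto intro!: exI[of _ "polygamma_pos (Suc n)"])
  qed (simp add: polygamma_pos_nonneg)
  then show ?thesis
    by (simp add: completely_monotonic_on_iff_cm_upto)
qed

lemma polygamma_pos_antimono:
  assumes "n > 0" "0 < x" "x \<le> y"
  shows "polygamma_pos n y \<le> polygamma_pos n x"
proof (rule DERIV_nonpos_imp_nonincreasing[OF assms(3)])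
  fix t assume "x \<le> t" "t \<le> y"
  then show "\<exists>D. (polygamma_pos n has_real_derivative D) (at t) \<and> D \<le> 0"
    using assms polygamma_pos_has_derivative[of t n] polygamma_pos_nonneg[of "Suc n" t] by force
qed

text \<open>
  The recurrence says that \<open>P\<^bsub>n-1\<^esub>\<close> decreases by exactly \<open>(n-1)! / x\<^sup>n\<close> between \<open>x\<close> and \<open>x + 1\<close>. By the
  mean value theorem this number is a value of the decreasing function \<open>P\<^sub>n\<close> between these points.
\<close>

lemma polygamma_pos_bounds:
  assumes "n > 0" "x > 0"
  shows "polygamma_pos n (x + 1) \<le> fact (n - 1) / x ^ n"
    and "fact (n - 1) / x ^ n \<le> polygamma_pos n x"
proof -
  \<comment> \<open>The case \<open>k = 0\<close> is legitimate: \<open>P\<^sub>0 = - \<psi>\<close> obeys the same recurrence.\<close>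
  obtain k where k: "n = Suc k"
    using assms(1) gr0_implies_Suc by blast
  obtain z where z: "z > x" "z < x + 1"
    "polygamma_pos k (x + 1) - polygamma_pos k x = (x + 1 - x) * (- polygamma_pos n z)"
    using MVT2[of x "x + 1" "polygamma_pos k" "\<lambda>z. - polygamma_pos n z"]
      polygamma_pos_has_derivative assms(2) k by auto
  then have eq: "polygamma_pos n z = fact (n - 1) / x ^ n"
    using polygamma_pos_plus1[OF assms(2), of k] k by simp
  show "polygamma_pos n (x + 1) \<le> fact (n - 1) / x ^ n"
    using polygamma_pos_antimono[of n z "x + 1"] z assms eq by simp
  show "fact (n - 1) / x ^ n \<le> polygamma_pos n x"
    using polygamma_pos_antimono[of n x z] z assms eq by simp
qed

lemma polygamma_pos_upper:
  assumes "n > 0" "x > 0"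
  shows "polygamma_pos n x \<le> fact (n - 1) / x ^ n + fact n / x ^ Suc n"
  using polygamma_pos_bounds(1)[OF assms] polygamma_pos_plus1[OF assms(2), of n] by simp

lemma polygamma_pos_lower:
  assumes "n > 0" "x > 0"
  shows "polygamma_pos n x \<ge> fact n / x ^ Suc n"
  using polygamma_pos_nonneg[of n "x + 1"] polygamma_pos_plus1[OF assms(2), of n] assms by simp

lemma polygamma_pos_asymp_at_top:
  assumes "n > 0"
  shows "((\<lambda>x. x ^ n * polygamma_pos n x) \<longlongrightarrow> fact (n - 1)) at_top"
proof (rule tendsto_sandwich)
  show "eventually (\<lambda>x. fact (n - 1) \<le> x ^ n * polygamma_pos n x) at_top"
    using eventually_gt_at_top[of 0]
    by eventually_elim (use polygamma_pos_bounds(2)[OF assms] in \<open>auto simp: field_simps\<close>)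
  show "eventually (\<lambda>x. x ^ n * polygamma_pos n x \<le> fact (n - 1) + fact n / x) at_top"
    using eventually_gt_at_top[of 0]
  proof eventually_elim
    case (elim x)
    then have "x ^ n * polygamma_pos n x \<le> x ^ n * (fact (n - 1) / x ^ n + fact n / x ^ Suc n)"
      by (intro mult_left_mono polygamma_pos_upper assms) auto
    also have "\<dots> = fact (n - 1) + fact n / x"
      using elim by (simp add: field_simps)
    finally show ?case .
  qed
  show "((\<lambda>x. fact (n - 1) + fact n / x :: real) \<longlongrightarrow> fact (n - 1)) at_top"
    by real_asymp
qed auto

lemma polygamma_pos_asymp_at_0:
  assumes "n > 0"
  shows "((\<lambda>x. x ^ Suc n * polygamma_pos n x) \<longlongrightarrow> fact n) (at_right 0)"
proof (rule tendsto_sandwich)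
  have pos: "eventually (\<lambda>x::real. x > 0) (at_right 0)"
    by (simp add: eventually_at_right_less)
  then show "eventually (\<lambda>x. fact n \<le> x ^ Suc n * polygamma_pos n x) (at_right 0)"
    by eventually_elim (use polygamma_pos_lower[OF assms] in \<open>auto simp: field_simps\<close>)
  from pos show "eventually (\<lambda>x. x ^ Suc n * polygamma_pos n x \<le> fact n + fact (n - 1) * x)
      (at_right 0)"
  proof eventually_elim
    case (elim x)
    then have "x ^ Suc n * polygamma_pos n x
        \<le> x ^ Suc n * (fact (n - 1) / x ^ n + fact n / x ^ Suc n)"
      by (intro mult_left_mono polygamma_pos_upper assms) auto
    also have "\<dots> = fact n + fact (n - 1) * x"
      using elim by (simp add: field_simps)
    finally show ?case .
  qed
  show "((\<lambda>x. fact n + fact (n - 1) * x :: real) \<longlongrightarrow> fact n) (at_right 0)"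
    by real_asymp
qed auto

lemma polygamma_pos_power_tendsto_0_at_top:
  assumes "j < n"
  shows "((\<lambda>x. x ^ j * polygamma_pos n x) \<longlongrightarrow> 0) at_top"
proof -
  have "((\<lambda>x::real. inverse (x ^ (n - j))) \<longlongrightarrow> 0) at_top"
    using assms by (intro tendsto_inverse_0_at_top filterlim_pow_at_top filterlim_ident) auto
  from tendsto_mult[OF polygamma_pos_asymp_at_top[of n] this]
  have "((\<lambda>x. x ^ n * polygamma_pos n x * inverse (x ^ (n - j))) \<longlongrightarrow> 0) at_top"
    using assms by simp
  moreover have "eventually (\<lambda>x. x ^ n * polygamma_pos n x * inverse (x ^ (n - j)) =
      x ^ j * polygamma_pos n x) at_top"
    using eventually_gt_at_top[of 0]
    by eventually_elim (use assms in \<open>auto simp: field_simps simp flip: power_add\<close>)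
  ultimately show ?thesis
    by (rule Lim_transform_eventually)
qed

lemma polygamma_pos_power_tendsto_0_at_0:
  assumes "n > 0" "j > Suc n"
  shows "((\<lambda>x. x ^ j * polygamma_pos n x) \<longlongrightarrow> 0) (at_right 0)"
proof -
  have "((\<lambda>x::real. x ^ (j - Suc n)) \<longlongrightarrow> 0 ^ (j - Suc n)) (at_right 0)"
    by (intro tendsto_intros)
  then have "((\<lambda>x::real. x ^ (j - Suc n)) \<longlongrightarrow> 0) (at_right 0)"
    using assms by (simp add: power_0_left)
  from tendsto_mult[OF this polygamma_pos_asymp_at_0[OF assms(1)]]
  have "((\<lambda>x. x ^ (j - Suc n) * (x ^ Suc n * polygamma_pos n x)) \<longlongrightarrow> 0) (at_right 0)"
    by simp
  moreover have "x ^ (j - Suc n) * (x ^ Suc n * polygamma_pos n x) = x ^ j * polygamma_pos n x"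
    for x
    using assms by (simp only: mult.assoc[symmetric] flip: power_add) simp
  ultimately show ?thesis
    by (simp only:)
qed

lemma polygamma_pos_tendsto_0: "n > 0 \<Longrightarrow> (polygamma_pos n \<longlongrightarrow> 0) at_top"
  using polygamma_pos_power_tendsto_0_at_top[of 0 n] by simp

section \<open>Complete monotonicity\<close>

text \<open>
  The function is what is left of \<open>\<psi>'\<close> after the first two terms of its asymptotic expansion at infinity.
  These two terms are the ones for which the difference between \<open>x\<close> and \<open>x + 1\<close> is half the square
  of \<open>1/x - 1/(x + 1) = (1/x) (1/(x + 1))\<close>.
\<close>

lemma completely_monotonic_on_trigamma_remainder:
  "completely_monotonic_on {0<..} (\<lambda>x. polygamma_pos 1 x - (1 / x + 1 / (2 * x\<^sup>2)))"
proof (rule completely_monotonic_on_diffI)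
  have "completely_monotonic_on {0<..} (\<lambda>x. 1 / (x + 0) ^ 1 + (1 / 2) / (x + 0) ^ 2 :: real)"
    by (intro completely_monotonic_on_add completely_monotonic_on_power) auto
  then show "completely_monotonic_on {0<..} (\<lambda>x. 1 / x + 1 / (2 * x\<^sup>2))"
    by simp
  show "((\<lambda>x::real. 1 / x + 1 / (2 * x\<^sup>2)) \<longlongrightarrow> 0) at_top"
    by real_asymp
  \<comment> \<open>The shifts by 0 and the exponents 0 and 1 put all factors into the shape \<open>c / (x + a) ^ p\<close>.\<close>
  let ?s = "\<lambda>x::real. (1 / (x + 0) ^ 1) * (1 / (x + 1) ^ 1)"
  have cm: "completely_monotonic_on {0<..} (\<lambda>x. (1 / 2) / (x + 0) ^ 0 * (?s x * ?s x))"
    by (intro completely_monotonic_on_mult completely_monotonic_on_power) auto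
  show "completely_monotonic_on {0<..} (\<lambda>x. (polygamma_pos 1 x - (1 / x + 1 / (2 * x\<^sup>2))) -
      (polygamma_pos 1 (x + 1) - (1 / (x + 1) + 1 / (2 * (x + 1)\<^sup>2))))"
  proof (rule completely_monotonic_on_cong[OF _ _ cm])
    fix x :: real
    assume "x \<in> {0<..}"
    then have x: "x > 0" by simp
    have ab: "(1 / x) * (1 / (x + 1)) = 1 / x - 1 / (x + 1)"
      using x by (simp add: divide_simps)
    have "(1 / 2) / (x + 0) ^ 0 * (?s x * ?s x) = (1 / 2) * (1 / x - 1 / (x + 1))\<^sup>2"
      using ab by (simp add: power2_eq_square)
    also have "\<dots> = (1 / 2) * ((1 / x)\<^sup>2 + (1 / (x + 1))\<^sup>2) - (1 / x) * (1 / (x + 1))"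
      by (simp only: power2_diff) (simp add: algebra_simps)
    also have "\<dots> = (1 / 2) * ((1 / x)\<^sup>2 + (1 / (x + 1))\<^sup>2) - (1 / x - 1 / (x + 1))"
      by (simp only: ab)
    also have "\<dots> = (polygamma_pos 1 x - (1 / x + 1 / (2 * x\<^sup>2))) -
      (polygamma_pos 1 (x + 1) - (1 / (x + 1) + 1 / (2 * (x + 1)\<^sup>2)))"
      using polygamma_pos_plus1[OF x, of 1] by (simp add: power_divide power2_eq_square algebra_simps)
    finally show "(1 / 2) / (x + 0) ^ 0 * (?s x * ?s x) = \<dots>" .
  qed simp
qed (auto intro: completely_monotonic_on_polygamma_pos polygamma_pos_tendsto_0)

lemma completely_monotonic_on_polygamma_pos_square:
  assumes "m > 0"
  shows "completely_monotonic_on {0<..} (\<lambda>x. (polygamma_pos m x)\<^sup>2)"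
  using completely_monotonic_on_mult[of "{0<..}" "polygamma_pos m" "polygamma_pos m"]
    completely_monotonic_on_polygamma_pos[OF assms] by (simp add: power2_eq_square)

text \<open>
  By the recurrence, the difference between \<open>x\<close> and \<open>x + 1\<close> is
  \<open>P\<^sub>1\<^sup>2 - (P\<^sub>1 - 1/x\<^sup>2)\<^sup>2 - 2/x\<^sup>3 = (2/x\<^sup>2) (P\<^sub>1 - 1/x - 1/(2 x\<^sup>2))\<close>.
\<close>

lemma completely_monotonic_on_trigamma_square_minus_tetragamma:
  "completely_monotonic_on {0<..} (\<lambda>x. (polygamma_pos 1 x)\<^sup>2 - polygamma_pos 2 x)"
proof (rule completely_monotonic_on_diffI)
  have "((\<lambda>x. (polygamma_pos 1 x)\<^sup>2) \<longlongrightarrow> 0\<^sup>2) at_top"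
    by (intro tendsto_intros polygamma_pos_tendsto_0) simp
  then show "((\<lambda>x. (polygamma_pos 1 x)\<^sup>2) \<longlongrightarrow> 0) at_top"
    by simp
  have cm: "completely_monotonic_on {0<..}
      (\<lambda>x. 2 / (x + 0) ^ 2 * (polygamma_pos 1 x - (1 / x + 1 / (2 * x\<^sup>2))))"
    by (intro completely_monotonic_on_mult completely_monotonic_on_power
        completely_monotonic_on_trigamma_remainder) auto
  show "completely_monotonic_on {0<..} (\<lambda>x. ((polygamma_pos 1 x)\<^sup>2 - polygamma_pos 2 x) -
      ((polygamma_pos 1 (x + 1))\<^sup>2 - polygamma_pos 2 (x + 1)))"
  proof (rule completely_monotonic_on_cong[OF _ _ cm])
    fix x :: real
    assume "x \<in> {0<..}"
    then have x: "x > 0" by simp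
    then show "2 / (x + 0) ^ 2 * (polygamma_pos 1 x - (1 / x + 1 / (2 * x\<^sup>2))) =
        ((polygamma_pos 1 x)\<^sup>2 - polygamma_pos 2 x) -
        ((polygamma_pos 1 (x + 1))\<^sup>2 - polygamma_pos 2 (x + 1))"
      unfolding polygamma_pos_plus1[OF x]
      by (simp add: field_simps power2_eq_square power3_eq_cube fact_numeral eval_nat_numeral)
  qed simp
qed (auto intro: completely_monotonic_on_polygamma_pos completely_monotonic_on_polygamma_pos_square
    polygamma_pos_tendsto_0)

section \<open>Sign changes\<close>

lemma polygamma_fun_even:
  "polygamma_fun m (2 * n) x = (polygamma_pos m x)\<^sup>2 - polygamma_pos (2 * n) x"
  by (simp add: polygamma_fun_def polygamma_pos_def power_mult_distrib flip: power_mult)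

lemma polygamma_fun_odd:
  "n > 0 \<Longrightarrow> polygamma_fun m (2 * n - 1) x = (polygamma_pos m x)\<^sup>2 + polygamma_pos (2 * n - 1) x"
  by (simp add: polygamma_fun_def polygamma_pos_def power_mult_distrib flip: power_mult)

text \<open>
  The factor \<open>x\<^sup>j\<close> is positive, so a nonzero limit of \<open>x\<^sup>j f(x)\<close> at either end of the half-line reveals the
  sign of \<open>f\<close> near that end.
\<close>

lemma power_scaled_limit_imp_sign:
  fixes f :: "real \<Rightarrow> real"
  assumes lim: "((\<lambda>x. x ^ j * f x) \<longlongrightarrow> L) F"
    and F: "eventually (\<lambda>x. x > 0) F" "F \<noteq> bot"
  shows "L > 0 \<Longrightarrow> \<exists>x>0. f x > 0" and "L < 0 \<Longrightarrow> \<exists>x>0. f x < 0"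
proof -
  assume "L > 0"
  then have "eventually (\<lambda>x. x > 0 \<and> x ^ j * f x > 0) F"
    using order_tendstoD(1)[OF lim] F(1) by (auto intro: eventually_conj)
  from eventually_happens'[OF F(2) this] show "\<exists>x>0. f x > 0"
    by (auto simp: zero_less_mult_iff)
next
  assume "L < 0"
  then have "eventually (\<lambda>x. x > 0 \<and> x ^ j * f x < 0) F"
    using order_tendstoD(2)[OF lim] F(1) by (auto intro: eventually_conj)
  from eventually_happens'[OF F(2) this] show "\<exists>x>0. f x < 0"
    by (auto simp: mult_less_0_iff dest: zero_less_power[of _ j])
qed

lemma polygamma_fun_even_signs:
  assumes "m > 0" "n > 0" "(m, n) \<noteq> (1, 1)"
  shows "\<exists>x>0. polygamma_fun m (2 * n) x > 0" "\<exists>x>0. polygamma_fun m (2 * n) x < 0"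
proof -
  let ?f = "polygamma_fun m (2 * n)" and ?p = polygamma_pos
  have top: "eventually (\<lambda>x::real. x > 0) at_top" "(at_top :: real filter) \<noteq> bot"
    by auto
  have zero: "eventually (\<lambda>x::real. x > 0) (at_right 0)" "at_right (0::real) \<noteq> bot"
    by (auto simp: eventually_at_right_less)
  \<comment> \<open>An even scaling exponent is distributed evenly over the square.\<close>
  have split: "x ^ (2 * j) * ?f x = (x ^ j * ?p m x)\<^sup>2 - x ^ (2 * j) * ?p (2 * n) x" for j x
    by (simp only: polygamma_fun_even right_diff_distrib power_mult_distrib power_even_eq)
  have "(\<exists>x>0. ?f x > 0) \<and> (\<exists>x>0. ?f x < 0)"
  proof (cases "m < n")
    case True
    have "((\<lambda>x. x ^ (2 * m) * ?f x) \<longlongrightarrow> (fact (m - 1))\<^sup>2 - 0) at_top"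
      unfolding split using True assms
      by (intro tendsto_intros polygamma_pos_asymp_at_top polygamma_pos_power_tendsto_0_at_top) auto
    from power_scaled_limit_imp_sign(1)[OF this top] have "\<exists>x>0. ?f x > 0"
      by simp
    \<comment> \<open>At 0 the scaling exponent \<open>2n + 1\<close> exceeds the order \<open>2m + 2\<close> of the pole of the square by
      \<open>2(n - m) - 1 \<ge> 1\<close>, so the square does not contribute to the limit.\<close>
    moreover have "((\<lambda>x. x ^ (2 * (n - m) - 1) * (x ^ Suc m * ?p m x)\<^sup>2
        - x ^ Suc (2 * n) * ?p (2 * n) x) \<longlongrightarrow>
        0 ^ (2 * (n - m) - 1) * (fact m)\<^sup>2 - fact (2 * n)) (at_right 0)"
      using assms by (intro tendsto_intros polygamma_pos_asymp_at_0) auto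
    then have "((\<lambda>x. x ^ Suc (2 * n) * ?f x) \<longlongrightarrow> - fact (2 * n)) (at_right 0)"
    proof -
      have e: "Suc (2 * n) = (2 * (n - m) - 1) + 2 * Suc m"
        using True by simp
      have "x ^ Suc (2 * n) * (?p m x)\<^sup>2 = x ^ (2 * (n - m) - 1) * (x ^ Suc m * ?p m x)\<^sup>2" for x
        unfolding e power_add power_mult_distrib power_even_eq by (simp only: mult.assoc)
      then have "x ^ Suc (2 * n) * ?f x = x ^ (2 * (n - m) - 1) * (x ^ Suc m * ?p m x)\<^sup>2
          - x ^ Suc (2 * n) * ?p (2 * n) x" for x
        by (simp only: polygamma_fun_even right_diff_distrib)
      moreover have "(0::real) ^ (2 * (n - m) - 1) = 0"
        using True by (simp add: power_0_left)
      ultimately show ?thesis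
        using \<open>(_ \<longlongrightarrow> 0 ^ (2 * (n - m) - 1) * (fact m)\<^sup>2 - fact (2 * n)) (at_right 0)\<close>
        by (simp only: mult_zero_left diff_0)
    qed
    from power_scaled_limit_imp_sign(2)[OF this zero] have "\<exists>x>0. ?f x < 0"
      by simp
    ultimately show ?thesis
      by simp
  next
    case False
    have "((\<lambda>x. x ^ (2 * Suc m) * ?f x) \<longlongrightarrow> (fact m)\<^sup>2 - 0) (at_right 0)"
      unfolding split using False assms
      by (intro tendsto_intros polygamma_pos_asymp_at_0 polygamma_pos_power_tendsto_0_at_0) auto
    from power_scaled_limit_imp_sign(1)[OF this zero] have "\<exists>x>0. ?f x > 0"
      by simp
    moreover have "\<exists>x>0. ?f x < 0"
    proof (cases "m = n")
      case True
      with assms have n: "n \<ge> 2"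
        by auto
      have "fact (n - 1) * fact (n - 1) \<le> (fact (2 * n - 2) :: nat)"
      proof -
        have "2 * n - 2 = (n - 1) + (n - 1)"
          using n by simp
        then show ?thesis
          using fact_fact_dvd_fact[of "n - 1" "n - 1", where 'a = nat]
          by (intro dvd_imp_le) simp_all
      qed
      also have "\<dots> < fact (2 * n - 1)"
        using n by (intro fact_less_mono_nat) auto
      finally have "real (fact (n - 1) * fact (n - 1)) < real (fact (2 * n - 1))"
        by (simp only: of_nat_less_iff)
      then have "(fact (n - 1))\<^sup>2 - (fact (2 * n - 1) :: real) < 0"
        by (simp add: power2_eq_square)
      moreover have "((\<lambda>x. x ^ (2 * n) * ?f x) \<longlongrightarrow> (fact (n - 1))\<^sup>2 - fact (2 * n - 1)) at_top"
        unfolding split unfolding True using assms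
        by (intro tendsto_intros polygamma_pos_asymp_at_top) auto
      ultimately show ?thesis
        using power_scaled_limit_imp_sign(2)[OF _ top] by blast
    next
      case neq: False
      have "((\<lambda>x. x ^ (2 * n) * ?f x) \<longlongrightarrow> 0\<^sup>2 - fact (2 * n - 1)) at_top"
        unfolding split using neq False assms
        by (intro tendsto_intros polygamma_pos_asymp_at_top polygamma_pos_power_tendsto_0_at_top) auto
      from power_scaled_limit_imp_sign(2)[OF this top] show ?thesis
        by simp
    qed
    ultimately show ?thesis
      by simp
  qed
  then show "\<exists>x>0. ?f x > 0" "\<exists>x>0. ?f x < 0"
    by auto
qed

text \<open>
  A function that increases to its limit 0 is nowhere positive, and one that decreases to it is nowhere negative.
\<close>

lemma tendsto_0_sign_change_imp_not_monotone:
  fixes f :: "real \<Rightarrow> real"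
  assumes lim: "(f \<longlongrightarrow> 0) at_top" and pos: "\<exists>x>0. f x > 0" and neg: "\<exists>x>0. f x < 0"
  shows "\<not> mono_on {0<..} f" "\<not> antimono_on {0<..} f"
proof -
  show "\<not> mono_on {0<..} f"
  proof
    assume mono: "mono_on {0<..} f"
    from pos obtain x where x: "x > 0" "f x > 0"
      by auto
    have "eventually (\<lambda>y. f y \<ge> f x) at_top"
      using eventually_ge_at_top[of x]
      by eventually_elim (use mono x in \<open>auto simp: monotone_on_def\<close>)
    with lim have "f x \<le> 0"
      by (intro tendsto_lowerbound) auto
    with x show False by simp
  qed
  show "\<not> antimono_on {0<..} f"
  proof
    assume antimono: "antimono_on {0<..} f"
    from neg obtain x where x: "x > 0" "f x < 0"
      by auto
    have "eventually (\<lambda>y. f y \<le> f x) at_top"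
      using eventually_ge_at_top[of x]
      by eventually_elim (use antimono x in \<open>auto simp: monotone_on_def\<close>)
    with lim have "0 \<le> f x"
      by (intro tendsto_upperbound) auto
    with x show False by simp
  qed
qed

lemma polygamma_fun_even_tendsto_0:
  assumes "m > 0" "n > 0"
  shows "(polygamma_fun m (2 * n) \<longlongrightarrow> 0) at_top"
proof -
  have "((\<lambda>x. (polygamma_pos m x)\<^sup>2 - polygamma_pos (2 * n) x) \<longlongrightarrow> 0\<^sup>2 - 0) at_top"
    using assms by (intro tendsto_intros polygamma_pos_tendsto_0) auto
  then show ?thesis
    by (simp add: polygamma_fun_even [abs_def])
qed

theorem theorem1:
  shows "completely_monotonic_on {0<..} (polygamma_fun 1 2) \<and>
         (\<forall>m n. m \<ge> 1 \<longrightarrow> n \<ge> 1 \<longrightarrow>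
           completely_monotonic_on {0<..} (polygamma_fun m (2 * n - 1))) \<and>
         (\<forall>m n. m \<ge> 1 \<longrightarrow> n \<ge> 1 \<longrightarrow> (m, n) \<noteq> (1, 1) \<longrightarrow>
           \<not> mono_on {0<..} (polygamma_fun m (2 * n)) \<and>
           \<not> antimono_on {0<..} (polygamma_fun m (2 * n)) \<and>
           (\<exists>x>0. polygamma_fun m (2 * n) x > 0) \<and>
           (\<exists>x>0. polygamma_fun m (2 * n) x < 0))"
proof (intro conjI allI impI)
  show "completely_monotonic_on {0<..} (polygamma_fun 1 2)"
    using completely_monotonic_on_trigamma_square_minus_tetragamma
    by (simp flip: polygamma_fun_even[of 1 1, simplified])
next
  fix m n :: nat
  assume mn: "m \<ge> 1" "n \<ge> 1"
  then have "completely_monotonic_on {0<..}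
      (\<lambda>x. (polygamma_pos m x)\<^sup>2 + polygamma_pos (2 * n - 1) x)"
    by (intro completely_monotonic_on_add completely_monotonic_on_polygamma_pos_square
        completely_monotonic_on_polygamma_pos) auto
  moreover have "polygamma_fun m (2 * n - 1) =
      (\<lambda>x. (polygamma_pos m x)\<^sup>2 + polygamma_pos (2 * n - 1) x)"
    using mn polygamma_fun_odd[of n m] by (intro ext) simp
  ultimately show "completely_monotonic_on {0<..} (polygamma_fun m (2 * n - 1))"
    by simp
next
  fix m n :: nat
  assume mn: "m \<ge> 1" "n \<ge> 1" "(m, n) \<noteq> (1, 1)"
  then show signs: "\<exists>x>0. polygamma_fun m (2 * n) x > 0" "\<exists>x>0. polygamma_fun m (2 * n) x < 0"
    using polygamma_fun_even_signs by simp_all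
  show "\<not> mono_on {0<..} (polygamma_fun m (2 * n))" "\<not> antimono_on {0<..} (polygamma_fun m (2 * n))"
    using mn signs
    by (intro tendsto_0_sign_change_imp_not_monotone polygamma_fun_even_tendsto_0; simp)+
qed

end
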